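(* For every $\varepsilon>0$ and every $\Delta_0$, there exist an integer $\Delta\geq\Delta_0$ and a graph $G$ with maximum degree $\Delta$ and minimum degree $\delta=\frac{\log_2\Delta}{2}$ such that, writing $n=|V(G)|$, every spanning subgraph $H\subseteq G$ that admits an identifying code satisfies $$(1-\varepsilon)\,n\leq\gamma^{\mathrm{ID}}(H)\leq n .$$ (That is, for arbitrarily large values of $\Delta$ there is such a graph $G$ with $\gamma^{\mathrm{ID}}(H)=(1-o(1))n$ for all its spanning subgraphs $H$.)
   Context: Graphs are finite, simple and undirected. For a vertex $v$, $N[v]=N(v)\cup\{v\}$ is its closed neighborhood. A set $C\subseteq V(H)$ is an identifying code of $H$ if it is dominating ($N[v]\cap C\neq\emptyset$ for every vertex $v$) and separating ($N[u]\cap C\neq N[v]\cap C$ for every pair of distinct vertices $u,v$). If $H$ admits an identifying code (equivalently, has no two distinct vertices with equal closed neighborhoods), $\gamma^{\mathrm{ID}}(H)$ denotes the minimum size of an identifying code of $H$. A spanning subgraph of $G$ is a subgraph with vertex set $V(G)$. *)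

theory Defs
  imports Complex_Main "Graph_Theory.Graph_Theory"
begin

text \<open>
  A finite simple undirected graph is a \<open>pair_graph\<close>: a finite loop-free symmetric digraph whose
  arcs are pairs of vertices, an undirected edge \<open>uv\<close> being the two arcs \<open>(u, v)\<close> and
  \<open>(v, u)\<close>.
\<close>

definition nbhd :: "('a, 'b) pre_digraph \<Rightarrow> 'a \<Rightarrow> 'a set" where
  "nbhd G v = {w. v \<rightarrow>\<^bsub>G\<^esub> w}"

definition closed_nbhd :: "('a, 'b) pre_digraph \<Rightarrow> 'a \<Rightarrow> 'a set" where
  "closed_nbhd G v = nbhd G v \<union> {v}"

text \<open>
  As each edge at \<open>v\<close> contributes exactly one arc leaving \<open>v\<close>, the degree of \<open>v\<close> is its
  \<open>out_degree\<close>. The following two values are meaningful only if the graph is finite and has at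
  least one vertex.
\<close>

definition max_degree :: "('a, 'b) pre_digraph \<Rightarrow> nat" where
  "max_degree G = Max (out_degree G ` verts G)"

definition min_degree :: "('a, 'b) pre_digraph \<Rightarrow> nat" where
  "min_degree G = Min (out_degree G ` verts G)"

definition dominating_set :: "('a, 'b) pre_digraph \<Rightarrow> 'a set \<Rightarrow> bool" where
  "dominating_set G C \<longleftrightarrow> (\<forall>v \<in> verts G. closed_nbhd G v \<inter> C \<noteq> {})"

definition separating_set :: "('a, 'b) pre_digraph \<Rightarrow> 'a set \<Rightarrow> bool" where
  "separating_set G C \<longleftrightarrow>
     (\<forall>u \<in> verts G. \<forall>v \<in> verts G. u \<noteq> v \<longrightarrow> closed_nbhd G u \<inter> C \<noteq> closed_nbhd G v \<inter> C)"

definition identifying_code :: "('a, 'b) pre_digraph \<Rightarrow> 'a set \<Rightarrow> bool" where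
  "identifying_code G C \<longleftrightarrow> C \<subseteq> verts G \<and> dominating_set G C \<and> separating_set G C"

definition admits_identifying_code :: "('a, 'b) pre_digraph \<Rightarrow> bool" where
  "admits_identifying_code G \<longleftrightarrow> (\<exists>C. identifying_code G C)"

text \<open>Unspecified if \<open>G\<close> has no identifying code.\<close>

definition gamma_ID :: "('a, 'b) pre_digraph \<Rightarrow> nat" where
  "gamma_ID G = (LEAST k. \<exists>C. identifying_code G C \<and> card C = k)"

end

(* The witness is the complete bipartite graph with sides of sizes d and 4^d. In a spanning
   subgraph, a vertex of the large side that lies outside a code C is identified by a subset of
   the small side, so C misses at most 2^d vertices of the large side, while n = d + 4^d. *)
theory Submission
  imports Defs
begin

lemma nbhd_eq_out_arcs: "nbhd (with_proj G) v = snd ` out_arcs (with_proj G) v"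
  by (force simp: nbhd_def out_arcs_def)

text \<open>Arcs of a \<open>with_proj\<close> graph are pairs, so an arc leaving \<open>v\<close>
  is determined by its head; there are no parallel arcs to overcount.\<close>

lemma out_degree_eq_card_nbhd: "out_degree (with_proj G) v = card (nbhd (with_proj G) v)"
proof -
  have "inj_on snd (out_arcs (with_proj G) v)"
    by (auto simp: inj_on_def out_arcs_def)
  then show ?thesis
    by (simp add: nbhd_eq_out_arcs out_degree_def card_image)
qed

lemma gamma_ID_le:
  assumes "identifying_code G C"
  shows "gamma_ID G \<le> card C"
  unfolding gamma_ID_def using assms by (intro Least_le) blast

lemma gamma_ID_attained:
  assumes "admits_identifying_code G"
  obtains C where "identifying_code G C" and "card C = gamma_ID G"
proof -
  have "\<exists>k C. identifying_code G C \<and> card C = k"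
    using assms by (auto simp: admits_identifying_code_def)
  from LeastI_ex[OF this] show ?thesis
    using that unfolding gamma_ID_def by blast
qed

text \<open>For \<open>b\<close> outside \<open>C\<close>, adding \<open>b\<close> to its
  neighborhood does not change the trace on \<open>C\<close>, so this trace lies inside
  \<open>A\<close>. Separation makes these traces pairwise distinct, and \<open>A\<close> has only
  \<open>2 ^ card A\<close> subsets.\<close>

lemma card_diff_separating_set_le:
  assumes "separating_set G C" and "B \<subseteq> verts G" and "finite A"
    and nbhd: "\<And>b. b \<in> B \<Longrightarrow> nbhd G b \<subseteq> A"
  shows "card (B - C) \<le> 2 ^ card A"
proof -
  have outside: "closed_nbhd G b \<inter> C = nbhd G b \<inter> C" if "b \<notin> C" for b
    using that by (auto simp: closed_nbhd_def)
  have "inj_on (\<lambda>b. nbhd G b \<inter> C) (B - C)"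
  proof (rule inj_onI, rule ccontr)
    fix u v
    assume uv: "u \<in> B - C" "v \<in> B - C" "nbhd G u \<inter> C = nbhd G v \<inter> C" "u \<noteq> v"
    then have "closed_nbhd G u \<inter> C = closed_nbhd G v \<inter> C"
      by (simp add: outside)
    moreover have "u \<in> verts G" "v \<in> verts G"
      using uv assms(2) by auto
    ultimately show False
      using assms(1) \<open>u \<noteq> v\<close> by (simp add: separating_set_def)
  qed
  moreover have "(\<lambda>b. nbhd G b \<inter> C) ` (B - C) \<subseteq> Pow A"
    using nbhd by blast
  ultimately have "card (B - C) \<le> card (Pow A)"
    by (rule card_inj_on_le) (simp add: \<open>finite A\<close>)
  then show ?thesis
    using \<open>finite A\<close> by (simp add: card_Pow)
qed

definition complete_bipartite :: "nat \<Rightarrow> nat \<Rightarrow> nat pair_pre_digraph" where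
  "complete_bipartite a b = \<lparr> pverts = {..<a + b},
     parcs = {..<a} \<times> {a..<a + b} \<union> {a..<a + b} \<times> {..<a} \<rparr>"

lemma pverts_complete_bipartite [simp]: "pverts (complete_bipartite a b) = {..<a + b}"
  by (simp add: complete_bipartite_def)

lemma pair_graph_complete_bipartite: "pair_graph (complete_bipartite a b)"
  by unfold_locales (auto simp: complete_bipartite_def arcs_ends_def arc_to_ends_def sym_def symmetric_def)

lemma nbhd_complete_bipartite:
  "nbhd (with_proj (complete_bipartite a b)) v =
    (if v < a then {a..<a + b} else if v < a + b then {..<a} else {})"
  by (auto simp: nbhd_def complete_bipartite_def)

text \<open>Each vertex is adjacent to the whole opposite side, so its degree is the size of that
  side. Positivity makes both sides nonempty, so that both values are attained.\<close>

lemma out_degree_complete_bipartite: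
  assumes "a > 0" and "b > 0"
  shows "out_degree (with_proj (complete_bipartite a b)) ` {..<a + b} = {a, b}"
proof -
  have "{..<a + b} = {..<a} \<union> {a..<a + b}"
    by auto
  moreover have "out_degree (with_proj (complete_bipartite a b)) ` {..<a} = {b}"
    using \<open>a > 0\<close> by (auto simp: out_degree_eq_card_nbhd nbhd_complete_bipartite image_constant_conv
      cong: image_cong_simp)
  moreover have "out_degree (with_proj (complete_bipartite a b)) ` {a..<a + b} = {a}"
    using \<open>b > 0\<close> by (auto simp: out_degree_eq_card_nbhd nbhd_complete_bipartite image_constant_conv
      cong: image_cong_simp)
  ultimately show ?thesis
    by (simp only: image_Un) auto
qed

lemma max_degree_complete_bipartite:
  "a > 0 \<Longrightarrow> b > 0 \<Longrightarrow> max_degree (with_proj (complete_bipartite a b)) = max a b"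
  by (simp add: max_degree_def out_degree_complete_bipartite)

lemma min_degree_complete_bipartite:
  "a > 0 \<Longrightarrow> b > 0 \<Longrightarrow> min_degree (with_proj (complete_bipartite a b)) = min a b"
  by (simp add: min_degree_def out_degree_complete_bipartite)

lemma nbhd_subgraph_mono: "subgraph H G \<Longrightarrow> nbhd H v \<subseteq> nbhd G v"
  unfolding nbhd_def by (blast intro: pre_digraph.adj_mono)

text \<open>Deleting edges only shrinks neighborhoods, so vertices of the side of size
  \<open>b\<close> still see only the side of size \<open>a\<close>, and the trace count applies to
  every \<open>H\<close>. The lower bound is stated additively to avoid truncated
  subtraction.\<close>

lemma gamma_ID_spanning_complete_bipartite:
  assumes "spanning (with_proj H) (with_proj (complete_bipartite a b))"
    and "admits_identifying_code (with_proj H)"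
  shows "b \<le> gamma_ID (with_proj H) + 2 ^ a" and "gamma_ID (with_proj H) \<le> a + b"
proof -
  let ?H = "with_proj H"
  obtain C where C: "identifying_code ?H C" "card C = gamma_ID ?H"
    using gamma_ID_attained assms(2) by blast
  have verts: "verts ?H = {..<a + b}" and sub: "subgraph ?H (with_proj (complete_bipartite a b))"
    using assms(1) by (auto simp: spanning_def)
  have C_sub: "C \<subseteq> {..<a + b}"
    using C(1) verts by (auto simp: identifying_code_def)
  show "gamma_ID ?H \<le> a + b"
    using card_mono[OF _ C_sub] C(2) by simp
  have "card ({a..<a + b} - C) \<le> 2 ^ card {..<a}"
  proof (rule card_diff_separating_set_le[where G = ?H])
    show "separating_set ?H C"
      using C(1) by (simp add: identifying_code_def)
    show "nbhd ?H v \<subseteq> {..<a}" if "v \<in> {a..<a + b}" for v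
      using nbhd_subgraph_mono[OF sub, of v] that by (simp add: nbhd_complete_bipartite)
    show "{a..<a + b} \<subseteq> verts ?H"
      unfolding verts by auto
  qed simp
  moreover have "card {a..<a + b} - card C \<le> card ({a..<a + b} - C)"
    using C_sub finite_subset by (intro diff_card_le_card_Diff) blast
  ultimately show "b \<le> gamma_ID ?H + 2 ^ a"
    using C(2) by simp
qed

theorem proposition12:
  fixes \<epsilon> :: real and \<Delta>\<^sub>0 :: nat
  assumes "\<epsilon> > 0"
  shows "\<exists>\<Delta> \<ge> \<Delta>\<^sub>0. \<Delta> > 0 \<and> (\<exists>G :: nat pair_pre_digraph.
    pair_graph G \<and> pverts G \<noteq> {} \<and>
    max_degree (with_proj G) = \<Delta> \<and>
    real (min_degree (with_proj G)) = log 2 (real \<Delta>) / 2 \<and>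
    (\<forall>H :: nat pair_pre_digraph.
      pair_graph H \<and> spanning (with_proj H) (with_proj G) \<and>
      admits_identifying_code (with_proj H) \<longrightarrow>
        (1 - \<epsilon>) * real (card (pverts G)) \<le> real (gamma_ID (with_proj H)) \<and>
        gamma_ID (with_proj H) \<le> card (pverts G)))"
proof -
  obtain k where k: "2 / \<epsilon> < 2 ^ k"
    using real_arch_pow[of 2 "2 / \<epsilon>"] by auto
  \<comment> \<open>The summand \<open>k\<close> makes \<open>2 ^ d\<close> at least 2 / \<epsilon>,
    the summand \<open>\<Delta>\<^sub>0\<close> makes \<open>4 ^ d\<close> large enough, and
    \<open>Suc\<close> keeps the small side nonempty.\<close>
  define d where "d = Suc (k + \<Delta>\<^sub>0)"
  have "(2::real) ^ k \<le> 2 ^ d"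
    by (intro power_increasing) (auto simp: d_def)
  with k have "2 / \<epsilon> \<le> 2 ^ d"
    by linarith
  then have "2 \<le> \<epsilon> * 2 ^ d"
    using pos_divide_le_eq[OF assms] by (simp add: mult.commute)
  then have "2 * 2 ^ d \<le> \<epsilon> * 2 ^ d * 2 ^ d"
    by (intro mult_right_mono) auto
  moreover have four: "(4::real) ^ d = 2 ^ d * 2 ^ d"
    by (simp flip: power_mult_distrib)
  ultimately have two_le: "2 * 2 ^ d \<le> \<epsilon> * 4 ^ d"
    by simp
  have "real d < 2 ^ d"
    using of_nat_less_two_power by blast
  moreover have "0 \<le> \<epsilon> * real d"
    using assms by simp
  \<comment> \<open>The term \<epsilon> * \<open>4 ^ d\<close> covers two copies of
    \<open>2 ^ d\<close>: one absorbs the \<open>d\<close> vertices of the small side, the other the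
    at most \<open>2 ^ d\<close> vertices of the large side that a code can miss.\<close>
  ultimately have bound: "(1 - \<epsilon>) * (real d + 4 ^ d) \<le> 4 ^ d - 2 ^ d"
    using two_le unfolding left_diff_distrib distrib_left by linarith
  have d_less: "d < 4 ^ d"
    by (rule power_gt_expt) simp
  have pos: "d > 0"
    by (simp add: d_def)
  let ?G = "complete_bipartite d (4 ^ d)"
  \<comment> \<open>This fixes the size of the large side: \<open>4 ^ d\<close> is
    \<open>2 ^ (2 * d)\<close>, so half its binary logarithm is exactly \<open>d\<close>, the
    minimum degree.\<close>
  have log: "log 2 (real (4 ^ d)) / 2 = real d"
    using log_pow_cancel[of 2 "2 * d"] by (simp add: power_mult)
  show ?thesis
  proof (intro exI[of _ "4 ^ d"] exI[of _ ?G] conjI allI impI)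
    show "\<Delta>\<^sub>0 \<le> 4 ^ d"
      using d_less by (simp add: d_def)
    show "max_degree (with_proj ?G) = 4 ^ d"
      using pos d_less by (simp add: max_degree_complete_bipartite)
    show "real (min_degree (with_proj ?G)) = log 2 (real (4 ^ d)) / 2"
      using pos d_less log by (simp add: min_degree_complete_bipartite)
  next
    fix H :: "nat pair_pre_digraph"
    assume "pair_graph H \<and> spanning (with_proj H) (with_proj ?G) \<and>
      admits_identifying_code (with_proj H)"
    then have H: "4 ^ d \<le> gamma_ID (with_proj H) + 2 ^ d" "gamma_ID (with_proj H) \<le> d + 4 ^ d"
      using gamma_ID_spanning_complete_bipartite by blast+
    \<comment> \<open>The bound is moved from naturals to reals, where the power
      \<open>2 ^ d\<close> can be subtracted and compared with \<open>bound\<close>.\<close>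
    from H(1) have "real (4 ^ d) \<le> real (gamma_ID (with_proj H) + 2 ^ d)"
      by (simp only: of_nat_le_iff)
    then show "(1 - \<epsilon>) * real (card (pverts ?G)) \<le> real (gamma_ID (with_proj H))"
      using bound by simp
    show "gamma_ID (with_proj H) \<le> card (pverts ?G)"
      using H(2) by simp
  qed (use pos in \<open>auto simp: pair_graph_complete_bipartite\<close>)
qed

end
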